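(* For every integer $m\ge 1$, $$A_m(x):=\sum_{n\ge m}a(n,m)x^n=x^mC(x)^{m-1},$$ and hence $$A(x,v)=\sum_{m\ge1}A_m(x)v^m=\frac{xv}{1-xvC(x)},$$ as identities of formal power series.
   Context: For a positive integer $n$, $\mathcal{L}_n$ denotes the set of all words $a=(a_1,a_2,\ldots,a_n)$ over the alphabet of non-negative integers satisfying: (i) $a_{i+1}\ge a_i-1$ for $1\le i<n$; and (ii) if $a_i=k>0$ with $i$ minimal (i.e. $i$ is the position of the left-most occurrence of the letter $k$), then there exist $i_1<i<i_2$ such that $a_{i_1}=a_{i_2}=k-1$. For $1\le m\le n$, $a(n,m)$ is the number of words in $\mathcal{L}_n$ containing exactly $m$ zeros, and $A(x,v)=\sum_{n\ge1}\sum_{m=1}^n a(n,m)x^nv^m$. $C(x)=\sum_{n\ge0}C_nx^n=\frac{1-\sqrt{1-4x}}{2x}$, where $C_n=\frac{1}{n+1}\binom{2n}{n}$ is the $n$-th Catalan number. *)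

theory Defs
  imports "HOL-Computational_Algebra.Formal_Power_Series"
begin

text \<open>
  A word \<open>(a\<^sub>1, \<dots>, a\<^sub>n)\<close> is a list of length \<open>n\<close>, indexed from \<open>0\<close>.
  The condition \<open>a\<^sub>i\<^sub>+\<^sub>1 \<ge> a\<^sub>i - 1\<close> is written without subtraction, since subtraction on
  \<^typ>\<open>nat\<close> truncates.
\<close>

definition words_L :: "nat \<Rightarrow> nat list set" where
  "words_L n = {w. length w = n \<and>
     (\<forall>i. Suc i < n \<longrightarrow> w ! i \<le> w ! Suc i + 1) \<and>
     (\<forall>i<n. \<forall>k. w ! i = k \<and> k > 0 \<and> (\<forall>j<i. w ! j \<noteq> k) \<longrightarrow>
        (\<exists>i1 i2. i1 < i \<and> i < i2 \<and> i2 < n \<and> w ! i1 = k - 1 \<and> w ! i2 = k - 1))}"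

definition a_num :: "nat \<Rightarrow> nat \<Rightarrow> nat" where
  "a_num n m = card {w \<in> words_L n. count_list w 0 = m}"

definition catalan :: "nat \<Rightarrow> rat" where
  "catalan n = 1 / of_nat (n + 1) * of_nat ((2 * n) choose n)"

definition C_fps :: "rat fps" where
  "C_fps = Abs_fps catalan"

definition A_fps :: "nat \<Rightarrow> rat fps" where
  "A_fps m = Abs_fps (\<lambda>n. if n \<ge> m then of_nat (a_num n m) else 0)"

text \<open>
  Formal power series in the two variables \<open>x\<close> and \<open>v\<close> are elements of \<open>\<rat>[[x]][[v]]\<close>, that is, of
  \<^typ>\<open>rat fps fps\<close>: the outer variable is \<open>v\<close>, the inner one is \<open>x\<close>, and the coefficient of
  \<open>x\<^sup>n v\<^sup>m\<close> in \<open>F\<close> is \<open>F $ m $ n\<close>.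
  Although \<^typ>\<open>rat fps\<close> is not a field, \<open>f / g\<close> is the genuine quotient whenever
  \<open>g $ 0 = 1\<close>, because the inverse of \<open>g\<close> is then built from \<open>inverse 1 = 1\<close>.
\<close>

abbreviation X_var :: "rat fps fps" where
  "X_var \<equiv> fps_const fps_X"

abbreviation V_var :: "rat fps fps" where
  "V_var \<equiv> fps_X"

definition A_bivariate :: "rat fps fps" where
  "A_bivariate = Abs_fps (\<lambda>m. Abs_fps (\<lambda>n.
     if 1 \<le> n \<and> 1 \<le> m \<and> m \<le> n then of_nat (a_num n m) else 0))"

end

theory Submission
  imports Defs
begin

text \<open>
  Everything rests on one reduction. From a word \<open>w\<close> of the family, delete the zeros and decrease
  every remaining letter by one. The result \<open>u\<close> is again a word of the family, shorter by the
  number of zeros deleted: the surviving letters keep their order, so left-most letters stay enclosed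
  by their predecessors, and the only such letter that can precede a deleted zero is a \<open>1\<close>, which
  becomes a \<open>0\<close> and starts no descent.

  The words over a given \<open>u\<close> can be counted. To rebuild \<open>w\<close>, a leading zero is forced, and the
  other zeros go in front of \<open>u\<close> or directly behind a letter \<open>0\<close> of \<open>u\<close> (a letter \<open>1\<close> of \<open>w\<close>):
  behind a larger letter a zero would be too steep a descent. If \<open>w\<close> has \<open>m + 1\<close> zeros and \<open>u\<close> has
  \<open>j\<close>, then \<open>m\<close> zeros are distributed over \<open>j + 1\<close> places, in \<open>(m + j) choose m\<close> ways
  (\<open>card_insertions\<close>). Exactly one of these ways is forbidden when \<open>u\<close> is not empty: if all zeros
  precede \<open>u\<close>, then no \<open>0\<close> follows the first \<open>1\<close> (\<open>nested_zero_Cons_iff\<close>). With \<open>a(n, m)\<close> the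
  number of words of length \<open>n\<close> with \<open>m\<close> zeros, this gives for \<open>k > 0\<close> the recurrence
  \<open>a_num_recurrence\<close>,
  \<open>a(m + 1 + k, m + 1) = (\<Sum>j=1..k. a(k, j) * (((m + j) choose j) - 1))\<close>,
  and \<open>a(m + 1, m + 1) = 1\<close>, which together determine all the numbers.

  It remains to see that the coefficients of \<open>x\<^sup>k\<close> in \<open>C(x)\<^sup>m\<close> satisfy the same recurrence
  (\<open>C_fps_power_coeff\<close>). Put \<open>y = x C(x)\<close>; the Catalan equation \<open>C = 1 + x C\<^sup>2\<close> says
  \<open>C = 1 / (1 - y)\<close>. Substituting \<open>y\<close> into the series
  \<open>1 / (1 - t)\<^bsup>m+1\<^esup> - 1 / (1 - t)\<close>, whose coefficients are \<open>((m + j) choose j) - 1\<close>, therefore gives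
  \<open>C\<^bsup>m+1\<^esup> - C\<close>, and division by \<open>C\<close> is the recurrence. The bivariate series is then a geometric
  series in \<open>v\<close>.
\<close>

unbundle fps_syntax

section \<open>Words as lists\<close>

definition slow_descent :: "nat list \<Rightarrow> bool" where
  "slow_descent = successively (\<lambda>x y. x \<le> Suc y)"

text \<open>
  The condition on left-most occurrences, phrased with the list split at the occurrence. Index-free
  splits survive the deletion of letters.
\<close>

definition nested :: "nat list \<Rightarrow> bool" where
  "nested w \<longleftrightarrow>
     (\<forall>p k s. w = p @ Suc k # s \<and> Suc k \<notin> set p \<longrightarrow> k \<in> set p \<and> k \<in> set s)"

lemma nestedD:
  "nested (p @ Suc k # s) \<Longrightarrow> Suc k \<notin> set p \<Longrightarrow> k \<in> set p \<and> k \<in> set s"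
  unfolding nested_def by blast

lemma nested_iff_nth:
  "nested w \<longleftrightarrow>
     (\<forall>i<length w. \<forall>k. w ! i = k \<and> k > 0 \<and> (\<forall>j<i. w ! j \<noteq> k) \<longrightarrow>
        (\<exists>i1 i2. i1 < i \<and> i < i2 \<and> i2 < length w \<and> w ! i1 = k - 1 \<and> w ! i2 = k - 1))"
    (is "_ \<longleftrightarrow> ?R")
proof
  assume N: "nested w"
  show ?R
  proof (intro allI impI, elim conjE)
    fix i k assume i: "i < length w" "w ! i = k" "k > 0" "\<forall>j<i. w ! j \<noteq> k"
    have w: "take i w @ Suc (k - 1) # drop (Suc i) w = w"
      using i id_take_nth_drop[of i w] by simp
    have "Suc (k - 1) \<notin> set (take i w)"
      using i by (auto simp: in_set_conv_nth)
    then have "k - 1 \<in> set (take i w)" "k - 1 \<in> set (drop (Suc i) w)"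
      using nestedD[of "take i w" "k - 1" "drop (Suc i) w"] N unfolding w by blast+
    then obtain j1 j2 where "j1 < i" "w ! j1 = k - 1"
      "j2 < length w - Suc i" "w ! (Suc i + j2) = k - 1"
      by (auto simp: in_set_conv_nth)
    then show "\<exists>i1 i2. i1 < i \<and> i < i2 \<and> i2 < length w \<and> w ! i1 = k - 1 \<and> w ! i2 = k - 1"
      by (intro exI[of _ j1] exI[of _ "Suc i + j2"]) auto
  qed
next
  assume R: ?R
  show "nested w"
    unfolding nested_def
  proof (intro allI impI, elim conjE)
    fix p k s assume w: "w = p @ Suc k # s" and p: "Suc k \<notin> set p"
    have "\<forall>j<length p. w ! j \<noteq> Suc k"
      using p by (metis nth_append nth_mem w)
    with R[rule_format, of "length p" "Suc k"] obtain i1 i2 where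
      i: "i1 < length p" "length p < i2" "i2 < length w" "w ! i1 = k" "w ! i2 = k"
      by (auto simp: w)
    have "k \<in> set p" using i by (auto simp: w nth_append)
    moreover obtain j where "i2 = Suc (length p + j)"
      using i by (auto simp: less_iff_Suc_add)
    then have "s ! j = k" "j < length s"
      using i by (auto simp: w nth_append)
    then have "k \<in> set s" by (metis nth_mem)
    ultimately show "k \<in> set p \<and> k \<in> set s" ..
  qed
qed

lemma words_L_iff: "w \<in> words_L n \<longleftrightarrow> length w = n \<and> slow_descent w \<and> nested w"
  unfolding nested_iff_nth words_L_def slow_descent_def successively_conv_nth by auto

section \<open>Deleting zeros and lowering letters\<close>

definition lower :: "nat list \<Rightarrow> nat list" where
  "lower w = map (\<lambda>x. x - 1) (filter (\<lambda>x. x \<noteq> 0) w)"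

lemma slow_descent_Nil [simp]: "slow_descent []"
  by (simp add: slow_descent_def)

lemma slow_descent_Cons:
  "slow_descent (x # w) \<longleftrightarrow> w = [] \<or> x \<le> Suc (hd w) \<and> slow_descent w"
  by (simp add: slow_descent_def successively_Cons)

lemma lower_simps [simp]:
  "lower [] = []" "lower (0 # w) = lower w" "lower (Suc x # w) = x # lower w"
  "lower (p @ s) = lower p @ lower s"
  by (simp_all add: lower_def)

lemma in_set_lower_iff [simp]: "k \<in> set (lower w) \<longleftrightarrow> Suc k \<in> set w"
  by (induction w) (auto simp: lower_def image_iff gr0_conv_Suc)

lemma length_lower: "length (lower w) + count_list w 0 = length w"
  by (induction w) (auto simp: lower_def)

lemma lower_eq_Nil_iff: "lower w = [] \<longleftrightarrow> w = replicate (length w) 0"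
  by (induction w) (auto simp: lower_def)

lemma map_Suc_lower: "0 \<notin> set w \<Longrightarrow> map Suc (lower w) = w"
  by (induction w) (auto simp: lower_def)

lemma lower_replicate_zero [simp]: "lower (replicate m 0) = []"
  by (induction m) auto

lemma lower_map_Suc [simp]: "lower (map Suc u) = u"
  by (induction u) auto

lemma count_list_replicate_same [simp]: "count_list (replicate m x) x = m"
  by (induction m) auto

lemma nested_hd: "nested (x # w) \<Longrightarrow> x = 0"
  using nestedD[of "[]" "x - 1" w] by (cases x) auto

text \<open>
  Deleting a stretch of zeros makes two letters \<open>x\<close>, \<open>y\<close> adjacent, but then \<open>x\<close> stood before a
  zero, so \<open>x = 1\<close>, and no descent starts there.
\<close>

lemma slow_descent_lower: "slow_descent w \<Longrightarrow> slow_descent (lower w)"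
proof (induction w)
  case (Cons x w)
  then show ?case
    by (cases x; cases w; cases "hd w") (auto simp: slow_descent_Cons)
qed simp

lemma lower_eq_appendE:
  assumes "lower w = p @ k # s"
  obtains p' s' where "w = p' @ Suc k # s'" "lower p' = p" "lower s' = s"
proof -
  have "\<exists>p' s'. w = p' @ Suc k # s' \<and> lower p' = p \<and> lower s' = s"
    using assms
  proof (induction w arbitrary: p)
    case (Cons x w)
    show ?case
    proof (cases x)
      case 0
      with Cons.prems Cons.IH[of p] obtain p' s'
        where "w = p' @ Suc k # s'" "lower p' = p" "lower s' = s" by auto
      then show ?thesis using 0 by (intro exI[of _ "0 # p'"] exI[of _ s']) simp
    next
      case (Suc y)
      show ?thesis
      proof (cases p)
        case Nil
        then show ?thesis using Cons.prems Suc by (intro exI[of _ "[]"] exI[of _ w]) simp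
      next
        case (Cons z q)
        with Cons.prems Cons.IH[of q] Suc obtain p' s'
          where "w = p' @ Suc k # s'" "lower p' = q" "lower s' = s" by auto
        then show ?thesis using Suc Cons Cons.prems
          by (intro exI[of _ "x # p'"] exI[of _ s']) simp
      qed
    qed
  qed simp
  then show ?thesis using that by blast
qed

lemma nested_lower:
  assumes "nested w" shows "nested (lower w)"
  unfolding nested_def
proof (intro allI impI, elim conjE)
  fix p k s assume e: "lower w = p @ Suc k # s" and k: "Suc k \<notin> set p"
  from e obtain p' s' where w: "w = p' @ Suc (Suc k) # s'"
    and ps: "lower p' = p" "lower s' = s"
    by (rule lower_eq_appendE)
  have "Suc (Suc k) \<notin> set p'" using k by (simp flip: ps)
  with assms w have "Suc k \<in> set p' \<and> Suc k \<in> set s'" by (auto dest: nestedD)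
  then show "k \<in> set p \<and> k \<in> set s" by (simp flip: ps)
qed

text \<open>
  Nestedness of a word and of its lowering differ only in the requirement on the letter \<open>1\<close>. The
  leading zero supplies the \<open>0\<close> before the first \<open>1\<close>. Since a nested lowering begins with \<open>0\<close>, the
  first nonzero letter is a \<open>1\<close>, so a \<open>0\<close> after it is missing exactly if all zeros form an initial
  block.
\<close>

lemma nested_zero_Cons_iff:
  "nested (0 # w) \<longleftrightarrow> nested (lower w) \<and>
     (lower w = [] \<or> w \<noteq> replicate (count_list w 0) 0 @ map Suc (lower w))"
    (is "_ \<longleftrightarrow> ?N \<and> ?E")
proof
  assume N: "nested (0 # w)"
  then have L: ?N using nested_lower[OF N] by simp
  moreover have ?E
  proof (rule ccontr)
    assume "\<not> ?E"
    then obtain x u where xu: "lower w = x # u"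
      and w: "w = replicate (count_list w 0) 0 @ map Suc (lower w)"
      by (cases "lower w") auto
    with L have "x = 0" by (auto dest: nested_hd)
    with xu w have "0 # w = (0 # replicate (count_list w 0) 0) @ Suc 0 # map Suc u"
      by simp
    with N have "0 \<in> set (map Suc u)"
      using nestedD[of "0 # replicate (count_list w 0) 0" 0 "map Suc u"] by auto
    then show False by auto
  qed
  ultimately show "?N \<and> ?E" ..
next
  assume A: "?N \<and> ?E"
  show "nested (0 # w)"
    unfolding nested_def
  proof (intro allI impI, elim conjE)
    fix p k s assume e: "0 # w = p @ Suc k # s" and k: "Suc k \<notin> set p"
    then obtain q where p: "p = 0 # q" and w: "w = q @ Suc k # s"
      by (cases p) auto
    have low: "lower w = lower q @ k # lower s" by (simp add: w)
    show "k \<in> set p \<and> k \<in> set s"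
    proof (cases k)
      case (Suc j)
      have "j \<in> set (lower q) \<and> j \<in> set (lower s)"
        using A k by (intro nestedD) (auto simp: low Suc p)
      then show ?thesis by (simp add: Suc p)
    next
      case 0
      (* The nested word lower w begins with 0, so the first nonzero letter of w is a 1. *)
      have "lower q = []"
      proof (cases "lower q")
        case (Cons x v)
        then have "x = 0" using A low nested_hd by auto
        then have "Suc 0 \<in> set q" using Cons in_set_lower_iff[of 0 q] by simp
        then show ?thesis using k 0 p by simp
      qed
      then have q: "q = replicate (length q) 0" by (simp add: lower_eq_Nil_iff)
      have "0 \<in> set s"
      proof (rule ccontr)
        assume s: "0 \<notin> set s"
        have "count_list w 0 = length q"
          using s length_lower[of q] \<open>lower q = []\<close>
          by (simp add: w count_list_append count_list_0_iff)
        then have "w = replicate (count_list w 0) 0 @ map Suc (lower w)"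
          using q s by (simp add: low \<open>lower q = []\<close> 0 map_Suc_lower) (simp add: w 0)
        with A low show False by simp
      qed
      then show ?thesis by (simp add: 0 p)
    qed
  qed
qed

section \<open>Counting the words with a given lowering\<close>

definition insertions :: "nat list \<Rightarrow> nat \<Rightarrow> nat list set" where
  "insertions u m = {w. slow_descent w \<and> lower w = u \<and> count_list w 0 = m}"

text \<open>
  The insertions with no zero in front. Counting both kinds at once makes recursion on \<open>u\<close> possible:
  behind a letter \<open>0\<close> of \<open>u\<close> zeros may follow, behind a larger one they may not.
\<close>

definition inner_insertions :: "nat list \<Rightarrow> nat \<Rightarrow> nat list set" where
  "inner_insertions u m = {w \<in> insertions u m. w = [] \<or> hd w \<noteq> 0}"

lemma insertions_0: "insertions u 0 = inner_insertions u 0"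
proof -
  have "w = [] \<or> hd w \<noteq> 0" if "count_list w 0 = 0" for w :: "nat list"
    using that by (cases w) (auto split: if_splits)
  then show ?thesis unfolding inner_insertions_def insertions_def by blast
qed

lemma insertions_Suc:
  "insertions u (Suc m) = inner_insertions u (Suc m) \<union> (#) 0 ` insertions u m"
proof (intro set_eqI)
  fix w
  show "w \<in> insertions u (Suc m) \<longleftrightarrow>
    w \<in> inner_insertions u (Suc m) \<union> (#) 0 ` insertions u m"
    by (cases w) (auto simp: inner_insertions_def insertions_def slow_descent_Cons image_iff)
qed

lemma inner_insertions_Nil: "inner_insertions [] m = (if m = 0 then {[]} else {})"
proof (intro set_eqI)
  fix w
  show "w \<in> inner_insertions [] m \<longleftrightarrow> w \<in> (if m = 0 then {[]} else {})"
    by (cases w; cases "hd w") (auto simp: inner_insertions_def insertions_def)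
qed

lemma inner_insertions_zero: "inner_insertions (0 # u) m = (#) (Suc 0) ` insertions u m"
proof (intro set_eqI)
  fix w
  show "w \<in> inner_insertions (0 # u) m \<longleftrightarrow> w \<in> (#) (Suc 0) ` insertions u m"
    by (cases w; cases "hd w")
       (auto simp: inner_insertions_def insertions_def slow_descent_Cons image_iff)
qed

lemma inner_insertions_Suc:
  assumes "slow_descent (Suc a # u)"
  shows "inner_insertions (Suc a # u) m = (#) (Suc (Suc a)) ` inner_insertions u m"
proof (intro set_eqI)
  fix w
  show "w \<in> inner_insertions (Suc a # u) m \<longleftrightarrow> w \<in> (#) (Suc (Suc a)) ` inner_insertions u m"
  proof (cases w)
    case w: (Cons x v)
    show ?thesis
      using assms by (cases x; cases v; cases "hd v")
       (auto simp: w inner_insertions_def insertions_def slow_descent_Cons image_iff)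
  qed (auto simp: inner_insertions_def insertions_def)
qed

text \<open>
  Splitting off a leading zero is Pascal's rule. The parameter \<open>z\<close> will be the number of zeros of \<open>u\<close>,
  which is the number of places for inner zeros. For \<open>z = 0\<close> the value of \<open>(m + z - 1) choose m\<close> is
  \<open>1\<close> if \<open>m = 0\<close> and \<open>0\<close> otherwise, as it should be, thanks to truncated subtraction.
\<close>

lemma card_insertions_if_inner:
  assumes "\<And>m. finite (inner_insertions u m)"
    and "\<And>m. card (inner_insertions u m) = (m + z - 1) choose m"
  shows "finite (insertions u m) \<and> card (insertions u m) = (m + z) choose m"
proof (induction m)
  case 0
  then show ?case using assms[of 0] by (simp add: insertions_0)
next
  case (Suc m)
  have "card (insertions u (Suc m)) =
      card (inner_insertions u (Suc m)) + card ((#) (0::nat) ` insertions u m)"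
    unfolding insertions_Suc
    by (rule card_Un_disjoint) (use assms Suc in \<open>auto simp: inner_insertions_def\<close>)
  also have "card ((#) (0::nat) ` insertions u m) = card (insertions u m)"
    by (rule card_image) simp
  finally show ?case using Suc assms by (simp add: insertions_Suc)
qed

lemma card_inner_insertions:
  assumes "slow_descent u"
  shows "finite (inner_insertions u m) \<and>
    card (inner_insertions u m) = (m + count_list u 0 - 1) choose m"
  using assms
proof (induction u arbitrary: m)
  case Nil
  then show ?case by (simp add: inner_insertions_Nil binomial_eq_0)
next
  case (Cons a u)
  from Cons.prems have "slow_descent u" by (auto simp: slow_descent_Cons)
  note IH = Cons.IH[OF this]
  show ?case
  proof (cases a)
    case 0
    then show ?thesis
      using card_insertions_if_inner[of u "count_list u 0" m] IH
      by (simp add: inner_insertions_zero card_image)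
  next
    case (Suc b)
    then show ?thesis
      using inner_insertions_Suc[of b u] IH Cons.prems by (simp add: card_image)
  qed
qed

lemma card_insertions:
  assumes "slow_descent u"
  shows "finite (insertions u m)"
    and "card (insertions u m) = (m + count_list u 0) choose m"
  using card_insertions_if_inner[of u "count_list u 0" m] card_inner_insertions[OF assms]
  by auto

section \<open>The recurrence for the number of words\<close>

text \<open>
  With the forced leading zero split off, \<open>m\<close> zeros remain to be inserted into \<open>u\<close>, and the insertion
  taken away puts all of them in front. The empty \<open>u\<close> is exempt: it has no letter to enclose.
\<close>

lemma words_L_decomposition:
  "{w \<in> words_L (Suc m + k). count_list w 0 = Suc m} =
     (\<Union>u\<in>words_L k. (#) 0 `
       (insertions u m - (if u = [] then {} else {replicate m 0 @ map Suc u})))"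
    (is "?A = ?B")
proof (intro set_eqI)
  fix w
  show "w \<in> ?A \<longleftrightarrow> w \<in> ?B"
  proof (cases "\<exists>v. w = 0 # v")
    case True
    then obtain v where w: "w = 0 # v" ..
    have "w \<in> ?A \<longleftrightarrow> count_list v 0 = m \<and> length (lower v) = k \<and> slow_descent v
        \<and> nested (0 # v)"
      using length_lower[of v] by (auto simp: w words_L_iff slow_descent_Cons)
    also have "\<dots> \<longleftrightarrow> w \<in> ?B"
      using slow_descent_lower[of v]
      by (auto simp: nested_zero_Cons_iff w words_L_iff insertions_def image_iff)
    finally show ?thesis .
  next
    case False
    then have "w \<notin> ?A" by (cases w) (auto simp: words_L_iff dest: nested_hd)
    with False show ?thesis by auto
  qed
qed

lemma finite_words_L: "finite (words_L n)"
proof (induction n rule: less_induct)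
  case (less n)
  show ?case
  proof (cases "n = 0")
    case True
    then show ?thesis by (auto simp: words_L_def)
  next
    case False
    have "finite {w \<in> words_L n. count_list w 0 = Suc m}" if "m < n" for m
    proof -
      have n: "n = Suc m + (n - Suc m)" using that by simp
      have "finite (words_L (n - Suc m))" using False by (intro less.IH) simp
      then show ?thesis
        by (subst n, subst words_L_decomposition)
           (auto simp: words_L_iff intro!: card_insertions(1))
    qed
    moreover have "words_L n \<subseteq> (\<Union>m<n. {w \<in> words_L n. count_list w 0 = Suc m})"
    proof
      fix w assume w: "w \<in> words_L n"
      with False obtain v where v: "w = 0 # v"
        by (cases w) (auto simp: words_L_iff dest: nested_hd)
      with w count_le_length[of v 0] show "w \<in> (\<Union>m<n. {w \<in> words_L n. count_list w 0 = Suc m})"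
        by (auto simp: words_L_iff)
    qed
    ultimately show ?thesis by (meson finite_UN_I finite_lessThan finite_subset lessThan_iff)
  qed
qed

lemma words_L_0: "words_L 0 = {[]}"
  by (auto simp: words_L_def)

lemma a_num_same: "a_num (Suc m) (Suc m) = 1"
proof -
  have "a_num (Suc m) (Suc m) = card ((#) (0::nat) ` insertions [] m)"
    using words_L_decomposition[of m 0] by (simp add: a_num_def words_L_0)
  then show ?thesis by (simp add: card_image card_insertions(2))
qed

text \<open>
  The words are grouped by their lowering \<open>u\<close>, and the \<open>u\<close> by their number \<open>j\<close> of zeros. The term
  for \<open>j = 0\<close> vanishes, since \<open>((m + 0) choose 0) - 1 = 0\<close>.
\<close>

lemma a_num_recurrence:
  assumes "k > 0"
  shows "a_num (Suc m + k) (Suc m) = (\<Sum>j=1..k. a_num k j * (((m + j) choose j) - 1))"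
proof -
  define h where "h j = ((m + j) choose j) - 1" for j
  define F where "F u = insertions u m - {replicate m 0 @ map Suc u}" for u
  have F: "finite (F u) \<and> card (F u) = h (count_list u 0)" if "u \<in> words_L k" for u
  proof -
    have "slow_descent u" using that by (simp add: words_L_iff)
    note c = card_insertions[OF this, of m]
    have "replicate m 0 @ map Suc u \<in> insertions u m"
    proof -
      have "slow_descent (map Suc u)"
        using \<open>slow_descent u\<close> by (simp add: slow_descent_def successively_map)
      then have "slow_descent (replicate m 0 @ map Suc u)"
        by (induction m) (auto simp: slow_descent_Cons)
      then show ?thesis
        by (simp add: insertions_def count_list_0_iff)
    qed
    with c show ?thesis
      using binomial_symmetric[of m "m + count_list u 0"] by (simp add: F_def h_def)
  qed
  have ne: "u \<noteq> []" if "u \<in> words_L k" for u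
    using that assms by (auto simp: words_L_iff)
  have disj: "(#) 0 ` F u \<inter> (#) 0 ` F v = {}" if "u \<noteq> v" for u v
    using that by (auto simp: F_def insertions_def)
  have "{w \<in> words_L (Suc m + k). count_list w 0 = Suc m} = (\<Union>u\<in>words_L k. (#) 0 ` F u)"
    unfolding words_L_decomposition using ne by (auto simp: F_def)
  then have "a_num (Suc m + k) (Suc m) = card (\<Union>u\<in>words_L k. (#) 0 ` F u)"
    by (simp add: a_num_def)
  also have "\<dots> = (\<Sum>u\<in>words_L k. card ((#) 0 ` F u))"
    using F disj by (intro card_UN_disjoint) (auto simp: finite_words_L)
  also have "\<dots> = (\<Sum>u\<in>words_L k. h (count_list u 0))"
    using F by (intro sum.cong) (auto simp: card_image)
  also have "\<dots> = (\<Sum>j\<le>k. \<Sum>u\<in>{u \<in> words_L k. count_list u 0 = j}. h (count_list u 0))"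
    by (rule sum.group[symmetric]) (auto simp: finite_words_L words_L_iff count_le_length)
  also have "\<dots> = (\<Sum>j\<le>k. a_num k j * h j)"
    by (intro sum.cong) (auto simp: a_num_def)
  also have "\<dots> = (\<Sum>j=1..k. a_num k j * h j)"
    by (rule sum.mono_neutral_right) (auto simp: h_def not_less_eq_eq)
  finally show ?thesis by (simp add: h_def)
qed

section \<open>The Catalan series\<close>

lemma catalan_Suc: "of_nat (n + 2) * catalan (Suc n) = (4 * of_nat n + 2) * catalan n"
proof -
  have "Suc n * (2 * Suc n choose Suc n) = (2 * Suc n) * (Suc (2 * n) choose n)"
    using Suc_times_binomial_eq[of "Suc (2 * n)" n] by (simp add: mult.commute)
  moreover have "Suc n * (Suc (2 * n) choose n) = Suc (2 * n) * (2 * n choose n)"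
    using Suc_times_binomial_eq[of "2 * n" n] binomial_symmetric[of "Suc n" "Suc (2 * n)"]
    by (simp add: mult.commute)
  ultimately have "Suc n * (Suc n * (2 * Suc n choose Suc n)) =
      2 * Suc n * (Suc (2 * n) * (2 * n choose n))"
    by (metis mult.assoc mult.left_commute)
  then have "Suc n * (2 * Suc n choose Suc n) = 2 * (Suc (2 * n) * (2 * n choose n))"
    unfolding mult.assoc mult.left_commute[of 2] mult_cancel1 by blast
  then have "of_nat (Suc n) * of_nat (2 * Suc n choose Suc n) =
      2 * (of_nat (Suc (2 * n)) * (of_nat (2 * n choose n) :: rat))"
    by (metis of_nat_mult of_nat_numeral)
  then show ?thesis
    by (simp add: catalan_def field_simps del: mult_Suc_right binomial_Suc_Suc)
qed

text \<open>
  The quotient recurrence of the Catalan numbers is the differential equation \<open>(1 - 4x) D' = - 2 D\<close>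
  for \<open>D = 1 - 2 x C\<close>. Hence \<open>(1 - 4x) (D\<^sup>2)' = - 4 D\<^sup>2\<close>, so \<open>D\<^sup>2 = 1 - 4x\<close>, and the quadratic equation
  for \<open>C\<close> follows by expanding the square.
\<close>

lemma C_fps_equation: "C_fps = 1 + fps_X * C_fps ^ 2"
proof -
  define D where "D = 1 - 2 * fps_X * C_fps"
  have D0: "D $ 0 = 1" by (simp add: D_def)
  have DS: "D $ Suc n = - 2 * catalan n" for n
    by (simp add: D_def C_fps_def mult.assoc fps_numeral_fps_const)
  have D': "(1 - 4 * fps_X) * fps_deriv D = - 2 * D"
  proof (rule fps_ext)
    fix n
    show "((1 - 4 * fps_X) * fps_deriv D) $ n = (- 2 * D) $ n"
    proof (cases n)
      case 0
      then show ?thesis by (simp add: D0 DS catalan_def)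
    next
      case (Suc k)
      then show ?thesis
        using catalan_Suc[of k]
        by (simp add: DS fps_numeral_fps_const left_diff_distrib mult.assoc algebra_simps)
    qed
  qed
  define E where "E = D ^ 2"
  have "(1 - 4 * fps_X) * fps_deriv E = 2 * D * ((1 - 4 * fps_X) * fps_deriv D)"
    by (simp add: E_def power2_eq_square algebra_simps)
  also have "\<dots> = - 4 * E"
    unfolding D' by (simp add: E_def power2_eq_square)
  finally have "((1 - 4 * fps_X) * fps_deriv E) $ n = (- 4 * E) $ n" for n
    by simp
  then have ES: "of_nat (Suc n) * E $ Suc n = 4 * (of_nat n - 1) * E $ n" for n
    by (cases n)
       (auto simp: fps_numeral_fps_const left_diff_distrib mult.assoc algebra_simps
          dest: meta_spec[of _ n])
  have E: "E $ 0 = 1" "E $ 1 = - 4" "E $ Suc (Suc n) = 0" for n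
  proof -
    show "E $ 0 = 1" by (simp add: E_def D0 power2_eq_square)
    then show "E $ 1 = - 4" using ES[of 0] by simp
    show "E $ Suc (Suc n) = 0"
    proof (induction n)
      case 0
      then show ?case using ES[of 1] by simp
    next
      case (Suc n)
      then show ?case using ES[of "Suc (Suc n)"] by (simp del: of_nat_Suc)
    qed
  qed
  have "E = 1 - 4 * fps_X"
  proof (rule fps_ext)
    fix n show "E $ n = (1 - 4 * fps_X) $ n"
      using E by (cases n rule: nat.exhaust; cases "n - 1") (auto simp: fps_numeral_fps_const fps_X_def)
  qed
  then have "4 * fps_X * (C_fps - (1 + fps_X * C_fps ^ 2)) = 0"
    by (simp add: E_def D_def power2_eq_square algebra_simps)
  then show ?thesis by simp
qed

text \<open>
  The negative binomial series; multiplication by \<open>1 - x\<close> takes differences of the coefficients, and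
  Pascal's rule lowers \<open>p\<close>.
\<close>

lemma fps_binomial_column:
  "Abs_fps (\<lambda>n. of_nat ((p + n) choose n)) * (1 - fps_X) ^ Suc p = (1 :: rat fps)"
proof (induction p)
  case 0
  show ?case by (rule fps_ext) (auto simp: algebra_simps fps_one_nth gr0_conv_Suc)
next
  case (Suc p)
  have "Abs_fps (\<lambda>n. of_nat ((Suc p + n) choose n)) * (1 - fps_X) =
      Abs_fps (\<lambda>n. of_nat ((p + n) choose n) :: rat)"
  proof (rule fps_ext)
    fix n show "(Abs_fps (\<lambda>n. of_nat ((Suc p + n) choose n)) * (1 - fps_X)) $ n =
      Abs_fps (\<lambda>n. of_nat ((p + n) choose n) :: rat) $ n"
      by (cases n) (simp_all add: algebra_simps)
  qed
  then show ?case using Suc by (simp add: mult.assoc[symmetric])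
qed

text \<open>
  The substitution \<open>t = x C(x)\<close> into \<open>1 / (1 - t)\<^bsup>p+1\<^esup> - 1 / (1 - t)\<close>. This series has no constant term,
  so it is \<open>t * g(t)\<close>, and \<open>g\<close> instead of the full series is expanded: this is how the division of
  \<open>C\<^bsup>p+1\<^esup> - C\<close> by \<open>C\<close> shifts the exponent of \<open>C\<close> from \<open>j\<close> to \<open>j - 1\<close>.
\<close>

lemma C_fps_power_coeff:
  assumes "k > 0"
  shows "(C_fps ^ p) $ k =
    (\<Sum>j=1..k. (C_fps ^ (j - 1)) $ (k - j) * of_nat (((p + j) choose j) - 1))"
proof -
  define B where "B p = Abs_fps (\<lambda>n. of_nat ((p + n) choose n) :: rat)" for p
  define y where "y = fps_X * C_fps"
  define g where "g = fps_shift 1 (B p - B 0)"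
  have y0: "y $ 0 = 0" by (simp add: y_def)
  have yC: "(1 - y) * C_fps = 1"
    using C_fps_equation by (simp add: y_def power2_eq_square algebra_simps)
  have B: "B q oo y = C_fps ^ Suc q" for q
  proof -
    have "(B q * (1 - fps_X) ^ Suc q) oo y = 1"
      unfolding B_def fps_binomial_column by simp
    then have "(B q oo y) * (1 - y) ^ Suc q = 1"
      by (simp only: fps_compose_mult_distrib[OF y0] fps_compose_power[OF y0, symmetric]
          fps_compose_sub_distrib fps_compose_1 fps_X_fps_compose_startby0[OF y0])
    then have "C_fps ^ Suc q = (B q oo y) * (1 - y) ^ Suc q * C_fps ^ Suc q"
      by simp
    also have "\<dots> = (B q oo y) * ((1 - y) * C_fps) ^ Suc q"
      by (simp only: power_mult_distrib mult.assoc)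
    finally show ?thesis by (simp add: yC)
  qed
  have "B p - B 0 = fps_X * g"
    by (rule fps_ext) (auto simp: g_def B_def)
  then have "(B p oo y) - (B 0 oo y) = y * (g oo y)"
    by (simp only: fps_compose_sub_distrib[symmetric] fps_compose_mult_distrib[OF y0]
        fps_X_fps_compose_startby0[OF y0])
  then have "C_fps ^ Suc p - C_fps ^ Suc 0 = y * (g oo y)"
    by (simp only: B)
  then have "C_fps * (C_fps ^ p - 1) = C_fps * (fps_X * (g oo y))"
    by (simp add: y_def algebra_simps)
  moreover have "C_fps \<noteq> 0" using yC by auto
  ultimately have eq: "C_fps ^ p - 1 = fps_X * (g oo y)" by simp
  obtain i where k: "k = Suc i" using assms by (cases k) auto
  have "(C_fps ^ p) $ k = (g oo y) $ i"
    using arg_cong[OF eq, of "\<lambda>f. f $ k"] by (simp add: k)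
  also have "\<dots> = (\<Sum>j=0..i. g $ j * (y ^ j) $ i)"
    by (simp add: fps_compose_nth)
  also have "\<dots> = (\<Sum>j=0..i. (C_fps ^ j) $ (i - j) * of_nat (((p + Suc j) choose Suc j) - 1))"
    by (intro sum.cong)
       (auto simp: g_def B_def y_def power_mult_distrib fps_X_power_mult_nth of_nat_diff Suc_le_eq)
  also have "\<dots> = (\<Sum>j=1..k. (C_fps ^ (j - 1)) $ (k - j) * of_nat (((p + j) choose j) - 1))"
    unfolding k One_nat_def sum.shift_bounds_cl_Suc_ivl by simp
  finally show ?thesis .
qed

section \<open>The generating functions\<close>

lemma a_num_eq_coeff: "of_nat (a_num (Suc m + k) (Suc m)) = (C_fps ^ m) $ k"
proof (induction k arbitrary: m rule: less_induct)
  case (less k)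
  show ?case
  proof (cases "k = 0")
    case True
    then show ?thesis by (simp add: a_num_same C_fps_def catalan_def fps_power_zeroth)
  next
    case False
    have IH: "of_nat (a_num k j) = (C_fps ^ (j - 1)) $ (k - j)" if "j \<in> {1..k}" for j
      using less.IH[of "k - j" "j - 1"] that by simp
    have "of_nat (a_num (Suc m + k) (Suc m)) =
        (\<Sum>j=1..k. of_nat (a_num k j) * of_nat (((m + j) choose j) - 1) :: rat)"
      using False by (subst a_num_recurrence) auto
    also have "\<dots> = (C_fps ^ m) $ k"
      using False by (subst C_fps_power_coeff) (auto simp: IH)
    finally show ?thesis .
  qed
qed

lemma A_fps_eq: "A_fps (Suc m) = fps_X ^ Suc m * C_fps ^ m"
proof (rule fps_ext)
  fix n
  show "A_fps (Suc m) $ n = (fps_X ^ Suc m * C_fps ^ m) $ n"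
    using a_num_eq_coeff[of m "n - Suc m"]
    by (auto simp: A_fps_def fps_X_power_mult_nth simp del: power_Suc)
qed

lemma A_bivariate_nth_Suc: "A_bivariate $ Suc m = A_fps (Suc m)"
  by (rule fps_ext) (auto simp: A_bivariate_def A_fps_def)

lemma A_bivariate_nth_0: "A_bivariate $ 0 = 0"
  by (rule fps_ext) (auto simp: A_bivariate_def)

lemma A_bivariate_sums: "(\<lambda>k. fps_const (A_fps (Suc k)) * V_var ^ Suc k) sums A_bivariate"
proof -
  have "(\<Sum>i=0..n. fps_const (A_bivariate $ i) * fps_X ^ i) =
      (\<Sum>k<n. fps_const (A_fps (Suc k)) * V_var ^ Suc k)" for n
    by (simp add: atLeast0AtMost sum.atMost_shift A_bivariate_nth_0 A_bivariate_nth_Suc)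
  then show ?thesis using fps_notation[of A_bivariate] by (simp add: sums_def)
qed

text \<open>
  Series with coefficients in a ring that is not a field: a nonzero constant term alone would not
  make the divisor invertible.
\<close>

lemma fps_divide_eqI:
  fixes f g h :: "'a :: {comm_ring_1, inverse} fps"
  assumes "g $ 0 = 1" "inverse (1 :: 'a) = 1" "f * g = h"
  shows "f = h / g"
proof -
  have "g * inverse g = 1"
    using fps_right_inverse[of g "inverse (g $ 0)"] assms by (simp add: fps_inverse_def)
  then have "h * inverse g = f"
    by (simp add: assms(3)[symmetric] mult.assoc)
  moreover have "subdegree g = 0" using assms(1) by (simp add: subdegree_eq_0_iff)
  ultimately show ?thesis by (simp add: fps_divide_unit')
qed

lemma A_bivariate_closed_form:
  "A_bivariate = X_var * V_var / (1 - X_var * V_var * fps_const C_fps)"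
proof (rule fps_divide_eqI)
  show "A_bivariate * (1 - X_var * V_var * fps_const C_fps) = X_var * V_var"
  proof (rule fps_ext)
    fix n
    have "A_bivariate * (1 - X_var * V_var * fps_const C_fps) =
        A_bivariate - fps_X * (fps_const (fps_X * C_fps) * A_bivariate)"
      by (simp add: algebra_simps flip: fps_const_mult)
    moreover have "(A_bivariate - fps_X * (fps_const (fps_X * C_fps) * A_bivariate)) $ n =
        (X_var * V_var) $ n"
    proof (cases n)
      case (Suc m)
      then show ?thesis
        by (cases m)
           (simp_all add: A_bivariate_nth_0 A_bivariate_nth_Suc A_fps_eq del: fps_const_mult)
    qed (simp add: A_bivariate_nth_0)
    ultimately show "(A_bivariate * (1 - X_var * V_var * fps_const C_fps)) $ n =
        (X_var * V_var) $ n"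
      by (simp only:)
  qed
qed simp_all

theorem theorem2p8:
  shows "(\<forall>m\<ge>1. A_fps m = fps_X ^ m * C_fps ^ (m - 1)) \<and>
    (\<lambda>k. fps_const (A_fps (Suc k)) * V_var ^ Suc k) sums A_bivariate \<and>
    A_bivariate = X_var * V_var / (1 - X_var * V_var * fps_const C_fps)"
proof (intro conjI allI impI)
  fix m :: nat assume "m \<ge> 1"
  then show "A_fps m = fps_X ^ m * C_fps ^ (m - 1)"
    using A_fps_eq[of "m - 1"] by simp
qed (fact A_bivariate_sums A_bivariate_closed_form)+

end
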